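(* Let $p$ be a polynomial with complex coefficients, with zeros $\lambda_1,\dots,\lambda_n$ (including multiplicities) and critical points $\mu_1,\dots,\mu_{n-1}$ (including multiplicities). Then \[ \{\mu_1,\dots,\mu_{n-1}\} \subseteq \operatorname{conv}\left(\{\lambda_1,\dots,\lambda_n\}\right). \]
   Context: The critical points of a polynomial $p$ are the zeros of its derivative $p'$. For $S\subseteq\mathbb{C}$, $\operatorname{conv}(S)$ denotes the convex hull of $S$ in $\mathbb{C}$ (viewed as a real vector space). "Including multiplicities" means each zero is listed as many times as its multiplicity, so $p$ has degree $n$. *)

theory Defs
  imports "HOL-Analysis.Analysis" "HOL-Computational_Algebra.Computational_Algebra"
begin

end

theory Submission
  imports Defs
begin

text \<open>
  This is the Gauss--Lucas theorem. Write \<open>p = c \<Prod>\<^sub>i (X - \<lambda>\<^sub>i)\<close> and let \<open>z\<close> be a critical point.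
  If \<open>z\<close> is itself a zero of \<open>p\<close>, then it lies in the convex hull of the zeros trivially. Otherwise
  the logarithmic derivative \<open>p'(z) / p(z) = \<Sum>\<^sub>i 1 / (z - \<lambda>\<^sub>i)\<close> vanishes. Since
  \<open>1 / w = cnj w / \<bar>w\<bar>\<^sup>2\<close>, complex conjugation turns this into
  \<open>\<Sum>\<^sub>i (z - \<lambda>\<^sub>i) / \<bar>z - \<lambda>\<^sub>i\<bar>\<^sup>2 = 0\<close>: the point \<open>z\<close> is the centre of mass of the zeros \<open>\<lambda>\<^sub>i\<close>
  with the positive weights \<open>1 / \<bar>z - \<lambda>\<^sub>i\<bar>\<^sup>2\<close>, hence a convex combination of them.
\<close>

lemma poly_pderiv_prod_linear:
  fixes a :: "'i \<Rightarrow> 'a :: field"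
  assumes "finite I" and "\<And>i. i \<in> I \<Longrightarrow> z \<noteq> a i"
  shows "poly (pderiv (\<Prod>i\<in>I. [:- a i, 1:])) z
           = poly (\<Prod>i\<in>I. [:- a i, 1:]) z * (\<Sum>i\<in>I. 1 / (z - a i))"
  using assms
proof (induction I rule: finite_induct)
  case empty
  then show ?case by simp
next
  case (insert j I)
  define q where "q = (\<Prod>i\<in>I. [:- a i, 1:])"
  define s where "s = (\<Sum>i\<in>I. 1 / (z - a i))"
  have "z \<noteq> a j"
    using insert.prems by simp
  moreover have "poly (pderiv q) z = poly q z * s"
    using insert.IH insert.prems by (simp add: q_def s_def)
  ultimately have "poly (pderiv ([:- a j, 1:] * q)) z
      = poly ([:- a j, 1:] * q) z * (1 / (z - a j) + s)"
    by (simp only: pderiv_mult) (simp add: pderiv_pCons field_simps)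
  then show ?case
    by (simp only: prod.insert[OF insert.hyps] sum.insert[OF insert.hyps] q_def s_def)
qed

text \<open>
  An equilibrium statement: the hypothesis says that unit charges at the points \<open>a i\<close>, repelling with
  a force inversely proportional to the distance, exert no net force at \<open>z\<close>. Conjugating it exhibits
  \<open>z\<close> as a weighted mean of these points.
\<close>

lemma sum_inverse_diff_eq_0_imp_in_convex_hull:
  fixes a :: "'i \<Rightarrow> complex"
  assumes fin: "finite I" and ne: "I \<noteq> {}"
    and distinct: "\<And>i. i \<in> I \<Longrightarrow> z \<noteq> a i"
    and sum0: "(\<Sum>i\<in>I. 1 / (z - a i)) = 0"
  shows "z \<in> convex hull (a ` I)"
proof -
  define w where "w i = 1 / (cmod (z - a i))\<^sup>2" for i
  define W where "W = (\<Sum>i\<in>I. w i)"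
  have w_pos: "w i > 0" if "i \<in> I" for i
    using distinct[OF that] by (simp add: w_def)
  have W_pos: "W > 0"
    unfolding W_def using fin ne w_pos by (intro sum_pos) auto
  have inverse_eq: "cnj (1 / (z - a i)) = w i *\<^sub>R (z - a i)" for i
    by (subst complex_div_cnj) (simp add: w_def scaleR_conv_of_real)
  have "(\<Sum>i\<in>I. w i *\<^sub>R (z - a i)) = cnj (\<Sum>i\<in>I. 1 / (z - a i))"
    unfolding cnj_sum inverse_eq ..
  then have "(\<Sum>i\<in>I. w i *\<^sub>R (z - a i)) = 0"
    by (simp only: sum0 complex_cnj_zero)
  then have balance: "W *\<^sub>R z = (\<Sum>i\<in>I. w i *\<^sub>R a i)"
    by (simp add: W_def scaleR_diff_right sum_subtractf scaleR_left.sum)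
  have "(\<Sum>i\<in>I. (w i / W) *\<^sub>R a i) = (1 / W) *\<^sub>R (\<Sum>i\<in>I. w i *\<^sub>R a i)"
    by (simp add: scaleR_right.sum)
  also have "\<dots> = z"
    using W_pos by (simp flip: balance)
  finally have mean: "(\<Sum>i\<in>I. (w i / W) *\<^sub>R a i) = z" .
  have "(\<Sum>i\<in>I. (w i / W) *\<^sub>R a i) \<in> convex hull (a ` I)"
  proof (rule convex_sum[OF fin convex_convex_hull])
    show "(\<Sum>i\<in>I. w i / W) = 1"
      using W_pos by (simp add: W_def flip: sum_divide_distrib)
    show "0 \<le> w i / W" if "i \<in> I" for i
      using w_pos[OF that] W_pos by simp
    show "a i \<in> convex hull (a ` I)" if "i \<in> I" for i
      using that by (intro hull_inc imageI)
  qed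
  then show ?thesis
    by (simp only: mean)
qed

lemma critical_point_prod_linear_in_convex_hull:
  fixes a :: "'i \<Rightarrow> complex"
  assumes fin: "finite I" and ne: "I \<noteq> {}"
    and crit: "poly (pderiv (\<Prod>i\<in>I. [:- a i, 1:])) z = 0"
  shows "z \<in> convex hull (a ` I)"
proof (cases "z \<in> a ` I")
  case True
  then show ?thesis by (rule hull_inc)
next
  case False
  then have distinct: "z \<noteq> a i" if "i \<in> I" for i
    using that by auto
  have "poly (\<Prod>i\<in>I. [:- a i, 1:]) z \<noteq> 0"
    using fin distinct by (simp add: poly_prod)
  then have "(\<Sum>i\<in>I. 1 / (z - a i)) = 0"
    using crit poly_pderiv_prod_linear[OF fin distinct] by simp
  with fin ne distinct show ?thesis
    by (rule sum_inverse_diff_eq_0_imp_in_convex_hull)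
qed

theorem theorem8:
  fixes p :: "complex poly"
    and n :: nat
    and lam mu :: "nat \<Rightarrow> complex"
  assumes "degree p = n"
    and "n \<ge> 1"
    and "proots p = image_mset lam (mset_set {1..n})"
    and "proots (pderiv p) = image_mset mu (mset_set {1..n - 1})"
  shows "mu ` {1..n - 1} \<subseteq> convex hull (lam ` {1..n})"
proof
  fix z assume "z \<in> mu ` {1..n - 1}"
  then have "z \<in># proots (pderiv p)"
    using assms(4) by simp
  moreover have "pderiv p \<noteq> 0"
    using assms(1,2) by (simp add: pderiv_eq_0_iff)
  ultimately have crit: "poly (pderiv p) z = 0"
    by simp
  define q where "q = (\<Prod>i\<in>{1..n}. [:- lam i, 1:])"
  have "p = smult (lead_coeff p) (\<Prod>x\<in>#proots p. [:- x, 1:])"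
    by (rule complex_poly_decompose_multiset[symmetric])
  also have "(\<Prod>x\<in>#proots p. [:- x, 1:]) = q"
    by (simp add: assms(3) q_def prod_unfold_prod_mset image_mset.compositionality comp_def)
  finally have p_eq: "p = smult (lead_coeff p) q" .
  have "lead_coeff p \<noteq> 0"
    using assms(1,2) by auto
  moreover have "lead_coeff p * poly (pderiv q) z = 0"
    using crit by (subst (asm) p_eq) (simp add: pderiv_smult)
  ultimately have "poly (pderiv q) z = 0"
    by simp
  then show "z \<in> convex hull (lam ` {1..n})"
    unfolding q_def using assms(2)
    by (intro critical_point_prod_linear_in_convex_hull) auto
qed

end
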